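(* Let $u,v\in\{0,1\}^*$ be two finite Sturmian words, and take the symmetric pair of orders $0<_D1$, $1<_A0$ on $\{0,1\}$. Then $u$ and $v$ do not have mixed order type, i.e. if $i(u,v)>0$, then all order crossings are of the same type (at least one of $T_1(u,v)$, $T_2(u,v)$ is empty).
   Context: For nonempty words $w,z$ put $w^\omega=www\cdots$ and $w^{-\omega}=\cdots www$. Write $w<_D z$ if $w^\omega$ is lexicographically smaller than $z^\omega$ with respect to $<_D$ (reading left to right), and $w<_A z$ if $w^{-\omega}$ is reverse-lexicographically smaller than $z^{-\omega}$ with respect to $<_A$ (reading right to left). A finite Sturmian word is a nonempty word $u\in\{0,1\}^*$ whose language $L_u$ (the set of all finite factors of $u^\omega$) is balanced: if $axa,bxb\in L_u$ with $a,b\in\{0,1\}$ and $x\in\{0,1\}^*$, then $a=b$. Write $u=u_1\cdots u_s$, $v=v_1\cdots v_r$, indices of $u$ modulo $s$ and of $v$ modulo $r$; $u_{j+1}\cdots u_j$ denotes the conjugate $u_{j+1}\cdots u_su_1\cdots u_j$, and similarly $v_{i+1}\cdots v_i$. Let $R=\{(i,j):1\le i\le r,1\le j\le s\}$, $$T_1(u,v)=\{(i,j)\in R: v_i\ne u_j,\ u_{j+1}\cdots u_j<_A v_{i+1}\cdots v_i<_D u_{j+1}\cdots u_j\},$$ $$T_2(u,v)=\{(i,j)\in R: v_{i+1}\ne u_{j+1},\ v_{i+1}\cdots v_i<_A u_{j+1}\cdots u_j<_D v_{i+1}\cdots v_i\}.$$ The elements of $T_1(u,v)$ (resp. $T_2(u,v)$)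 represent the order crossings of Type 1 (resp. Type 2). The index is $i(u,v)=|T_1(u,v)|+|T_2(u,v)|$, and $u,v$ have mixed order type if $T_1(u,v)$ and $T_2(u,v)$ are both nonempty. *)

theory Defs
  imports "HOL-Library.Omega_Words_Fun"
begin

definition lex_less :: "('a \<Rightarrow> 'a \<Rightarrow> bool) \<Rightarrow> 'a word \<Rightarrow> 'a word \<Rightarrow> bool" where
  "lex_less lt x y \<longleftrightarrow> (\<exists>n. (\<forall>k<n. x k = y k) \<and> lt (x n) (y n))"

definition less_D :: "('a \<Rightarrow> 'a \<Rightarrow> bool) \<Rightarrow> 'a list \<Rightarrow> 'a list \<Rightarrow> bool" where
  "less_D ltD w z \<longleftrightarrow> lex_less ltD (w\<^sup>\<omega>) (z\<^sup>\<omega>)"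

(* A left-infinite word is represented by its right-to-left reading: position n is the
   (n+1)-st letter from the right end.  The left-infinite word ...www read from right to
   left is the omega power of the reversal of w. *)

definition left_iter :: "'a list \<Rightarrow> 'a word" where
  "left_iter w = (rev w)\<^sup>\<omega>"

definition less_A :: "('a \<Rightarrow> 'a \<Rightarrow> bool) \<Rightarrow> 'a list \<Rightarrow> 'a list \<Rightarrow> bool" where
  "less_A ltA w z \<longleftrightarrow> lex_less ltA (left_iter w) (left_iter z)"

definition language :: "'a list \<Rightarrow> 'a list set" where
  "language u = {x. \<exists>i j. x = u\<^sup>\<omega> [i \<rightarrow> j]}"

definition balanced :: "nat list set \<Rightarrow> bool" where
  "balanced L \<longleftrightarrow> (\<forall>a\<in>{0,1}. \<forall>b\<in>{0,1}. \<forall>x\<in>lists {0,1}.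
     [a] @ x @ [a] \<in> L \<and> [b] @ x @ [b] \<in> L \<longrightarrow> a = b)"

definition finite_sturmian :: "nat list \<Rightarrow> bool" where
  "finite_sturmian u \<longleftrightarrow> u \<noteq> [] \<and> u \<in> lists {0,1} \<and> balanced (language u)"

(* Letters are numbered from 1, with indices modulo the length: for w = w_1 ... w_s and
   k >= 1 this is w_k, so that letter w (s + 1) = w_1.  The conjugate
   w_{k+1} ... w_s w_1 ... w_k is rotate k w. *)

definition letter :: "'a list \<Rightarrow> nat \<Rightarrow> 'a" where
  "letter w k = w ! ((k - 1) mod length w)"

(* The first component i indexes the second word v, the second component j indexes u. *)

definition crossings1 ::
  "('a \<Rightarrow> 'a \<Rightarrow> bool) \<Rightarrow> ('a \<Rightarrow> 'a \<Rightarrow> bool) \<Rightarrow> 'a list \<Rightarrow> 'a list \<Rightarrow> (nat \<times> nat) set" where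
  "crossings1 ltD ltA u v = {(i, j) \<in> {1..length v} \<times> {1..length u}.
     letter v i \<noteq> letter u j \<and>
     less_A ltA (rotate j u) (rotate i v) \<and> less_D ltD (rotate i v) (rotate j u)}"

definition crossings2 ::
  "('a \<Rightarrow> 'a \<Rightarrow> bool) \<Rightarrow> ('a \<Rightarrow> 'a \<Rightarrow> bool) \<Rightarrow> 'a list \<Rightarrow> 'a list \<Rightarrow> (nat \<times> nat) set" where
  "crossings2 ltD ltA u v = {(i, j) \<in> {1..length v} \<times> {1..length u}.
     letter v (i + 1) \<noteq> letter u (j + 1) \<and>
     less_A ltA (rotate i v) (rotate j u) \<and> less_D ltD (rotate j u) (rotate i v)}"

definition crossing_index ::
  "('a \<Rightarrow> 'a \<Rightarrow> bool) \<Rightarrow> ('a \<Rightarrow> 'a \<Rightarrow> bool) \<Rightarrow> 'a list \<Rightarrow> 'a list \<Rightarrow> nat" where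
  "crossing_index ltD ltA u v = card (crossings1 ltD ltA u v) + card (crossings2 ltD ltA u v)"

definition mixed_order_type ::
  "('a \<Rightarrow> 'a \<Rightarrow> bool) \<Rightarrow> ('a \<Rightarrow> 'a \<Rightarrow> bool) \<Rightarrow> 'a list \<Rightarrow> 'a list \<Rightarrow> bool" where
  "mixed_order_type ltD ltA u v \<longleftrightarrow> crossings1 ltD ltA u v \<noteq> {} \<and> crossings2 ltD ltA u v \<noteq> {}"

(* The symmetric pair of orders on the letters 0 and 1. *)

definition ltD01 :: "nat \<Rightarrow> nat \<Rightarrow> bool" where
  "ltD01 a b \<longleftrightarrow> a = 0 \<and> b = 1"

definition ltA01 :: "nat \<Rightarrow> nat \<Rightarrow> bool" where
  "ltA01 a b \<longleftrightarrow> a = 1 \<and> b = 0"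

end

theory Submission
  imports Defs
begin

text \<open>For the symmetric pair of orders, a crossing of either type says that the two periodic words
  share a factor \<open>x\<close> which one of them surrounds by ones and the other by zeros: in Type 1 it is
  \<open>u\<close> that contains \<open>1x1\<close>, in Type 2 it is \<open>v\<close>.

  In a balanced word, two windows of equal length differ by at most one in their number of ones
  (\<open>window_ones_le_Suc\<close>).  Let \<open>N\<close> be the length of \<open>1x1\<close> and \<open>h\<close> the number of ones in
  \<open>x\<close>.  The word that contains \<open>1x1\<close> has a window of length \<open>N\<close> with \<open>h + 2\<close> ones and none with
  fewer than \<open>h + 1\<close>, so averaging the windows over a period shows that its density of ones exceeds
  \<open>(h + 1) / N\<close>.  The word that contains \<open>0x0\<close> has, for the same reason, density below
  \<open>(h + 1) / N\<close>.  Hence a crossing determines which of the two words has the greater density of ones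
  (\<open>outweighs_imp_denser\<close>), and crossings of both types would contradict each other.\<close>

text \<open>For a common factor \<open>x\<close> of length \<open>n\<close>, the word \<open>f\<close> contains \<open>1x1\<close> and \<open>g\<close> contains \<open>0x0\<close>.  For
  \<open>f = g\<close> this is exactly what balance forbids.\<close>

definition outweighs :: "nat word \<Rightarrow> nat word \<Rightarrow> bool" where
  "outweighs f g \<longleftrightarrow> (\<exists>p q n. f p = 1 \<and> g q = 0 \<and> (\<forall>k<n. f (Suc p + k) = g (Suc q + k)) \<and>
     f (Suc p + n) = 1 \<and> g (Suc q + n) = 0)"

definition ones :: "nat word \<Rightarrow> nat \<Rightarrow> nat \<Rightarrow> nat" where
  "ones f p n = (\<Sum>k<n. f (p + k))"

text \<open>While two windows of a balanced word grow, the difference of their weights moves by at most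
  one.  It cannot pass from 1 to 2: since it last rose from 0 to 1 the windows have agreed, so
  another rise would complete a pair \<open>1x1\<close>, \<open>0x0\<close>.  The second conclusion, which remembers that last
  rise, is what makes the induction go through.\<close>

lemma window_ones_le_Suc_aux:
  assumes bin: "\<And>k. f k \<le> 1" and bal: "\<not> outweighs f f"
  shows "ones f p n \<le> Suc (ones f q n) \<and>
    (ones f p n = Suc (ones f q n) \<longrightarrow> (\<exists>l<n. f (p + l) = 1 \<and> f (q + l) = 0 \<and>
       (\<forall>k. l < k \<and> k < n \<longrightarrow> f (p + k) = f (q + k))))"
proof (induction n)
  case 0
  then show ?case by (simp add: ones_def)
next
  case (Suc n)
  have step: "ones f p (Suc n) = ones f p n + f (p + n)" "ones f q (Suc n) = ones f q n + f (q + n)"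
    by (simp_all add: ones_def)
  have b: "f (p + n) \<le> 1" "f (q + n) \<le> 1"
    using bin by auto
  show ?case
  proof (cases "ones f p n = Suc (ones f q n)")
    case True
    then obtain l where l: "l < n" "f (p + l) = 1" "f (q + l) = 0"
      and agree: "\<And>k. l < k \<Longrightarrow> k < n \<Longrightarrow> f (p + k) = f (q + k)"
      using Suc.IH by blast
    have no_rise: "\<not> (f (p + n) = 1 \<and> f (q + n) = 0)"
    proof
      assume rise: "f (p + n) = 1 \<and> f (q + n) = 0"
      have "f (p + l) = 1 \<and> f (q + l) = 0 \<and>
          (\<forall>k < n - Suc l. f (Suc (p + l) + k) = f (Suc (q + l) + k)) \<and>
          f (Suc (p + l) + (n - Suc l)) = 1 \<and> f (Suc (q + l) + (n - Suc l)) = 0"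
        using l rise agree[of "Suc (l + k)" for k] by (auto simp: add.assoc)
      then show False
        using bal unfolding outweighs_def by blast
    qed
    show ?thesis
    proof (cases "f (p + n) = f (q + n)")
      case True
      then have "\<forall>k. l < k \<and> k < Suc n \<longrightarrow> f (p + k) = f (q + k)"
        using agree less_Suc_eq by auto
      then show ?thesis
        using \<open>ones f p n = Suc (ones f q n)\<close> True l step by (auto intro!: exI[of _ l])
    next
      case False
      then show ?thesis
        using \<open>ones f p n = Suc (ones f q n)\<close> no_rise b step by auto
    qed
  next
    case False
    then have le: "ones f p n \<le> ones f q n"
      using Suc.IH by simp
    have "f (p + n) = 1 \<and> f (q + n) = 0" if "ones f p (Suc n) = Suc (ones f q (Suc n))"
      using that le b step by linarith
    moreover have "ones f p (Suc n) \<le> Suc (ones f q (Suc n))"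
      using le b step by linarith
    ultimately show ?thesis
      by (auto intro!: exI[of _ n])
  qed
qed

lemma window_ones_le_Suc:
  assumes "\<And>k. f k \<le> 1" and "\<not> outweighs f f"
  shows "ones f p n \<le> Suc (ones f q n)"
  using window_ones_le_Suc_aux[where f = f, OF assms] by blast

lemma ones_period:
  assumes per: "\<And>k. f (k + s) = f k"
  shows "ones f p s = ones f 0 s"
proof (induction p)
  case (Suc p)
  have "ones f (Suc p) s + f p = ones f p (Suc s)"
    unfolding ones_def by (subst sum.lessThan_Suc_shift) simp
  also have "\<dots> = ones f p s + f p"
    using per by (simp add: ones_def)
  finally show ?case
    using Suc.IH by simp
qed simp

text \<open>Each of the \<open>n\<close> offsets inside the sliding window runs through one full period.\<close>

lemma sum_windows_over_period:
  assumes "\<And>k. f (k + s) = f k"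
  shows "(\<Sum>t<s. ones f (p + t) n) = n * ones f 0 s"
proof -
  have "(\<Sum>t<s. ones f (p + t) n) = (\<Sum>k<n. \<Sum>t<s. f (p + t + k))"
    unfolding ones_def by (rule sum.swap)
  also have "\<dots> = (\<Sum>k<n. ones f (p + k) s)"
    by (simp add: ones_def ac_simps)
  also have "\<dots> = (\<Sum>k<n. ones f 0 s)"
    by (intro sum.cong refl ones_period assms)
  also have "\<dots> = n * ones f 0 s"
    by simp
  finally show ?thesis .
qed

text \<open>By balance no window is lighter by more than one than the window at \<open>p\<close>.  That window itself
  exceeds this bound, and the averaging starts there, so that the inequality is strict.\<close>

lemma period_ones_lower:
  assumes per: "\<And>k. f (k + s) = f k" and "s > 0"
    and bin: "\<And>k. f k \<le> 1" and bal: "\<not> outweighs f f"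
    and pos: "ones f p n > 0"
  shows "s * (ones f p n - 1) < n * ones f 0 s"
proof -
  have "(\<Sum>t<s. ones f p n - 1) < (\<Sum>t<s. ones f (p + t) n)"
  proof (rule sum_strict_mono_ex1)
    show "\<forall>t\<in>{..<s}. ones f p n - 1 \<le> ones f (p + t) n"
      using window_ones_le_Suc[where f = f, OF bin bal] by (simp add: le_diff_conv)
    show "\<exists>t\<in>{..<s}. ones f p n - 1 < ones f (p + t) n"
      using pos \<open>s > 0\<close> by (intro bexI[of _ 0]) auto
  qed simp
  then show ?thesis
    using sum_windows_over_period[where f = f and s = s, OF per] by simp
qed

lemma period_ones_upper:
  assumes per: "\<And>k. f (k + s) = f k" and "s > 0"
    and bin: "\<And>k. f k \<le> 1" and bal: "\<not> outweighs f f"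
  shows "n * ones f 0 s < s * (ones f p n + 1)"
proof -
  have "(\<Sum>t<s. ones f (p + t) n) < (\<Sum>t<s. ones f p n + 1)"
  proof (rule sum_strict_mono_ex1)
    show "\<forall>t\<in>{..<s}. ones f (p + t) n \<le> ones f p n + 1"
      using window_ones_le_Suc[where f = f, OF bin bal] by simp
    show "\<exists>t\<in>{..<s}. ones f (p + t) n < ones f p n + 1"
      using \<open>s > 0\<close> by (intro bexI[of _ 0]) auto
  qed simp
  then show ?thesis
    using sum_windows_over_period[where f = f and s = s, OF per] by simp
qed

text \<open>The conclusion compares the densities \<open>ones f 0 s / s\<close> and \<open>ones g 0 r / r\<close>; both are compared
  with \<open>(h + 1) / N\<close>, where \<open>h\<close> is the number of ones in the common factor and \<open>N\<close> its length
  plus two.\<close>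

lemma outweighs_imp_denser:
  assumes perf: "\<And>k. f (k + s) = f k" and s: "s > 0"
    and perg: "\<And>k. g (k + r) = g k" and r: "r > 0"
    and binf: "\<And>k. f k \<le> 1" and bing: "\<And>k. g k \<le> 1"
    and balf: "\<not> outweighs f f" and balg: "\<not> outweighs g g"
    and fg: "outweighs f g"
  shows "s * ones g 0 r < r * ones f 0 s"
proof -
  obtain p q n where ends: "f p = 1" "g q = 0" "f (Suc p + n) = 1" "g (Suc q + n) = 0"
    and agree: "\<forall>k<n. f (Suc p + k) = g (Suc q + k)"
    using fg unfolding outweighs_def by blast
  define h where "h = ones f (Suc p) n"
  define N where "N = Suc (Suc n)"
  have decomp: "ones w i N = w i + ones w (Suc i) n + w (Suc i + n)" for w :: "nat word" and i
    unfolding ones_def N_def by (subst sum.lessThan_Suc_shift) simp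
  have "ones g (Suc q) n = h"
    using agree unfolding ones_def h_def by (intro sum.cong) auto
  then have wf: "ones f p N = h + 2" and wg: "ones g q N = h"
    using ends by (simp_all add: decomp h_def)
  have low: "s * (h + 1) < N * ones f 0 s"
    using period_ones_lower[where f = f and s = s and p = p and n = N, OF perf s binf balf] wf by simp
  have up: "N * ones g 0 r < r * (h + 1)"
    using period_ones_upper[where f = g and s = r and p = q and n = N, OF perg r bing balg] wg by simp
  have "N * (s * ones g 0 r) = s * (N * ones g 0 r)"
    by simp
  also have "\<dots> < s * (r * (h + 1))"
    using up s by simp
  also have "\<dots> = r * (s * (h + 1))"
    by (rule mult.left_commute)
  also have "\<dots> < r * (N * ones f 0 s)"
    using low r by simp
  also have "\<dots> = N * (r * ones f 0 s)"
    by simp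
  finally show ?thesis
    by simp
qed

lemma iter_periodic: "w \<noteq> [] \<Longrightarrow> w\<^sup>\<omega> (k + length w) = w\<^sup>\<omega> k"
  by (simp add: iter_def)

lemma iter_binary:
  assumes "w \<in> lists {0, 1}" and "w \<noteq> []"
  shows "w\<^sup>\<omega> k \<in> {0, 1}"
proof -
  have "w ! (k mod length w) \<in> set w"
    using assms(2) by simp
  then show ?thesis
    using assms by (auto simp: iter_def)
qed

lemma iter_rotate: "w \<noteq> [] \<Longrightarrow> (rotate j w)\<^sup>\<omega> k = w\<^sup>\<omega> (j + k)"
  by (simp add: iter_def nth_rotate mod_simps)

text \<open>Reading leftwards from the origin of a periodic word is reading leftwards from the end of
  sufficiently many copies of its period.\<close>

lemma left_iter_conv_iter:
  assumes "w \<noteq> []" and "k < M * length w"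
  shows "left_iter w k = w\<^sup>\<omega> (M * length w - Suc k)"
proof -
  define s where "s = length w"
  have s: "s > 0"
    using assms by (simp add: s_def)
  have div: "k div s < M"
    using assms s by (simp add: s_def div_less_iff_less_mult)
  define c where "c = M - Suc (k div s)"
  have "M = c + 1 + k div s"
    using div by (simp add: c_def)
  then have "M * s = c * s + s + k div s * s"
    by (simp add: add_mult_distrib)
  moreover have "k = k div s * s + k mod s" "k mod s < s"
    using s by simp_all
  ultimately have "M * s - Suc k = c * s + (s - Suc (k mod s))"
    by linarith
  then have "(M * s - Suc k) mod s = s - Suc (k mod s)"
    using s by simp
  then show ?thesis
    using assms s by (simp add: left_iter_def iter_def rev_nth s_def)
qed

text \<open>The two first differences, to the left and to the right of the origin, are the ends of the
  factors \<open>1x1\<close> and \<open>0x0\<close>.  The orders on the two sides are opposite, so the two hypotheses compare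
  the words in opposite directions and yet both give \<open>w\<close> the one.\<close>

lemma crossing_imp_outweighs:
  assumes w: "w \<noteq> []" and z: "z \<noteq> []"
    and A: "less_A ltA01 w z" and D: "less_D ltD01 z w"
  shows "outweighs (w\<^sup>\<omega>) (z\<^sup>\<omega>)"
proof -
  obtain a where a: "\<And>k. k < a \<Longrightarrow> left_iter w k = left_iter z k"
      "left_iter w a = 1" "left_iter z a = 0"
    using A unfolding less_A_def lex_less_def ltA01_def by blast
  obtain b where b: "\<And>k. k < b \<Longrightarrow> w\<^sup>\<omega> k = z\<^sup>\<omega> k" "w\<^sup>\<omega> b = 1" "z\<^sup>\<omega> b = 0"
    using D unfolding less_D_def lex_less_def ltD01_def by metis
  \<comment> \<open>Shift the origin by \<open>a + 1\<close> periods, which leaves room for \<open>a + 1\<close> letters on its left.\<close>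
  define O1 where "O1 = Suc a * length w"
  define O2 where "O2 = Suc a * length z"
  have room: "a < O1" "a < O2"
    using w z mult_le_mono2[of 1 "length w" "Suc a"] mult_le_mono2[of 1 "length z" "Suc a"]
    by (auto simp: O1_def O2_def Suc_le_eq)
  have left: "left_iter w k = w\<^sup>\<omega> (O1 - Suc k)" "left_iter z k = z\<^sup>\<omega> (O2 - Suc k)"
    if "k \<le> a" for k
    using left_iter_conv_iter[OF w, of k "Suc a"] left_iter_conv_iter[OF z, of k "Suc a"] room that
    unfolding O1_def O2_def by simp_all
  have right: "w\<^sup>\<omega> (O1 + k) = w\<^sup>\<omega> k" "z\<^sup>\<omega> (O2 + k) = z\<^sup>\<omega> k" for k
    unfolding O1_def O2_def using w z by (simp_all only: iter_def mod_mult_self3 if_False length_greater_0_conv)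
  define p where "p = O1 - Suc a"
  define q where "q = O2 - Suc a"
  have "w\<^sup>\<omega> (Suc p + k) = z\<^sup>\<omega> (Suc q + k)" if k: "k < a + b" for k
  proof (cases "k < a")
    case True
    then have "Suc p + k = O1 - Suc (a - Suc k)" "Suc q + k = O2 - Suc (a - Suc k)"
      using room by (auto simp: p_def q_def)
    then show ?thesis
      using left[of "a - Suc k"] a(1)[of "a - Suc k"] True by simp
  next
    case False
    then have "Suc p + k = O1 + (k - a)" "Suc q + k = O2 + (k - a)"
      using room by (auto simp: p_def q_def)
    then show ?thesis
      using right[of "k - a"] b(1)[of "k - a"] False k by (simp only:)
  qed
  moreover have "w\<^sup>\<omega> p = 1" "z\<^sup>\<omega> q = 0"
    using left[of a] a by (auto simp: p_def q_def)
  moreover have "Suc p + (a + b) = O1 + b" "Suc q + (a + b) = O2 + b"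
    using room by (auto simp: p_def q_def)
  then have "w\<^sup>\<omega> (Suc p + (a + b)) = 1" "z\<^sup>\<omega> (Suc q + (a + b)) = 0"
    using right b by (simp_all only:)
  ultimately show ?thesis
    unfolding outweighs_def by blast
qed

lemma outweighs_rotate:
  assumes "outweighs ((rotate j u)\<^sup>\<omega>) ((rotate i v)\<^sup>\<omega>)" and "u \<noteq> []" and "v \<noteq> []"
  shows "outweighs (u\<^sup>\<omega>) (v\<^sup>\<omega>)"
proof -
  have shift: "(rotate j u)\<^sup>\<omega> k = u\<^sup>\<omega> (j + k)" "(rotate i v)\<^sup>\<omega> k = v\<^sup>\<omega> (i + k)" for k
    using assms by (simp_all only: iter_rotate not_False_eq_True)
  obtain p q n where "u\<^sup>\<omega> (j + p) = 1 \<and> v\<^sup>\<omega> (i + q) = 0 \<and>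
      (\<forall>k<n. u\<^sup>\<omega> (Suc (j + p) + k) = v\<^sup>\<omega> (Suc (i + q) + k)) \<and>
      u\<^sup>\<omega> (Suc (j + p) + n) = 1 \<and> v\<^sup>\<omega> (Suc (i + q) + n) = 0"
    using assms(1) unfolding outweighs_def shift
    by (elim exE) (simp only: add_Suc add_Suc_right add.assoc)
  then show ?thesis
    unfolding outweighs_def by blast
qed

lemma finite_sturmian_not_outweighs_self:
  assumes "finite_sturmian u"
  shows "\<not> outweighs (u\<^sup>\<omega>) (u\<^sup>\<omega>)"
proof
  assume "outweighs (u\<^sup>\<omega>) (u\<^sup>\<omega>)"
  then obtain p q n where ends: "u\<^sup>\<omega> p = 1" "u\<^sup>\<omega> q = 0" "u\<^sup>\<omega> (Suc p + n) = 1" "u\<^sup>\<omega> (Suc q + n) = 0"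
    and agree: "\<forall>k<n. u\<^sup>\<omega> (Suc p + k) = u\<^sup>\<omega> (Suc q + k)"
    unfolding outweighs_def by blast
  define x where "x = map (u\<^sup>\<omega>) [Suc p..<Suc p + n]"
  have x': "x = map (u\<^sup>\<omega>) [Suc q..<Suc q + n]"
    unfolding x_def using agree by (intro nth_equalityI) (auto simp del: upt_Suc)
  have "[i..<Suc (Suc i + n)] = [i] @ [Suc i..<Suc i + n] @ [Suc i + n]" for i
    using upt_conv_Cons[of i "Suc (Suc i + n)"] upt_Suc_append[of "Suc i" "Suc i + n"]
    by (simp del: upt_Suc)
  then have factor: "u\<^sup>\<omega> [i \<rightarrow> Suc (Suc i + n)] =
      [u\<^sup>\<omega> i] @ map (u\<^sup>\<omega>) [Suc i..<Suc i + n] @ [u\<^sup>\<omega> (Suc i + n)]" for i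
    by (simp only: subsequence_def map_append list.map)
  have "[1] @ x @ [1] \<in> language u" "[0] @ x @ [0] \<in> language u"
    using factor[of p] factor[of q] ends unfolding language_def x_def[symmetric] x'[symmetric]
    by (metis (mono_tags, lifting) mem_Collect_eq)+
  moreover have "u\<^sup>\<omega> k \<in> {0, 1}" for k
    using assms iter_binary unfolding finite_sturmian_def by blast
  then have "x \<in> lists {0, 1}"
    unfolding x_def lists_eq_set set_map mem_Collect_eq by (rule image_subsetI)
  ultimately show False
    using assms unfolding finite_sturmian_def balanced_def by (metis insertCI zero_neq_one)
qed

theorem lemma2:
  fixes u v :: "nat list"
  assumes "finite_sturmian u" and "finite_sturmian v"
  shows "\<not> mixed_order_type ltD01 ltA01 u v \<and>
    (crossing_index ltD01 ltA01 u v > 0 \<longrightarrow>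
      crossings1 ltD01 ltA01 u v = {} \<or> crossings2 ltD01 ltA01 u v = {})"
proof -
  have ne: "u \<noteq> []" "v \<noteq> []"
    using assms by (auto simp: finite_sturmian_def)
  have bin: "u\<^sup>\<omega> k \<le> 1" "v\<^sup>\<omega> k \<le> 1" for k
    using assms iter_binary[of u k] iter_binary[of v k] by (auto simp: finite_sturmian_def)
  note bal = assms[THEN finite_sturmian_not_outweighs_self]
  have type1: "outweighs (u\<^sup>\<omega>) (v\<^sup>\<omega>)" if ne1: "crossings1 ltD01 ltA01 u v \<noteq> {}"
  proof -
    obtain i j where "less_A ltA01 (rotate j u) (rotate i v)" "less_D ltD01 (rotate i v) (rotate j u)"
      using ne1 by (auto simp: crossings1_def)
    then show ?thesis
      using ne crossing_imp_outweighs outweighs_rotate by (metis rotate_is_Nil_conv)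
  qed
  have type2: "outweighs (v\<^sup>\<omega>) (u\<^sup>\<omega>)" if ne2: "crossings2 ltD01 ltA01 u v \<noteq> {}"
  proof -
    obtain i j where "less_A ltA01 (rotate i v) (rotate j u)" "less_D ltD01 (rotate j u) (rotate i v)"
      using ne2 by (auto simp: crossings2_def)
    then show ?thesis
      using ne crossing_imp_outweighs outweighs_rotate by (metis rotate_is_Nil_conv)
  qed
  have "\<not> (outweighs (u\<^sup>\<omega>) (v\<^sup>\<omega>) \<and> outweighs (v\<^sup>\<omega>) (u\<^sup>\<omega>))"
  proof
    assume "outweighs (u\<^sup>\<omega>) (v\<^sup>\<omega>) \<and> outweighs (v\<^sup>\<omega>) (u\<^sup>\<omega>)"
    then have "length u * ones (v\<^sup>\<omega>) 0 (length v) < length v * ones (u\<^sup>\<omega>) 0 (length u)"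
      and "length v * ones (u\<^sup>\<omega>) 0 (length u) < length u * ones (v\<^sup>\<omega>) 0 (length v)"
      using ne bin bal by (auto intro!: outweighs_imp_denser iter_periodic)
    then show False
      by simp
  qed
  then have "crossings1 ltD01 ltA01 u v = {} \<or> crossings2 ltD01 ltA01 u v = {}"
    using type1 type2 by blast
  then show ?thesis
    unfolding mixed_order_type_def by blast
qed

end
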